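(* Let $K$ be a number field and let $S$ be a finite set of places of $K$ with $S\supseteq S_\infty$. Let $\phi_0(z)\in\mathcal{O}_S[z]$ be monic, let $\beta\in K\setminus\mathcal{O}_S$, and let $i$ be an integer with $0\le i<\deg(\phi_0)-1$. Then the polynomial $\phi(z):=\phi_0(z)+\beta z^i$ satisfies \[ \lvert \mathcal{O}_\phi(\alpha)\cap\mathcal{O}_S^*\rvert\le 1 \] for every $\alpha\in K$.
   Context: $S_\infty$ denotes the set of Archimedean places of $K$. $\mathcal{O}_S$ is the ring of $S$-integers of $K$ and $\mathcal{O}_S^*$ the group of $S$-units. For $\alpha\in K$, the orbit of $\alpha$ under $\phi$ is $\mathcal{O}_\phi(\alpha):=\{\phi^n(\alpha): n\ge 1\}$, where $\phi^n$ denotes the $n$-fold composition of $\phi$ with itself. *)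

theory Defs
  imports
    Complex_Main
    "HOL-Computational_Algebra.Polynomial"
begin

definition number_field :: "'k::field_char_0 itself \<Rightarrow> bool" where
  "number_field _ \<longleftrightarrow>
     (\<exists>B. finite_dimensional_vector_space (\<lambda>q (x :: 'k). of_rat q * x) B)"

lemma number_field_rat: "number_field TYPE(rat)"
proof -
  interpret Q: vector_space "\<lambda>q x :: rat. of_rat q * x"
    by unfold_locales (auto simp: algebra_simps of_rat_add of_rat_mult)
  have "UNIV \<subseteq> Q.span {1}"
  proof
    fix x :: rat
    have "of_rat x * 1 \<in> Q.span {1 :: rat}"
      by (intro Q.span_scale Q.span_base) simp
    then show "x \<in> Q.span {1}" by (simp add: of_rat_eq_id)
  qed
  then have "Q.span {1} = UNIV" by blast
  moreover have "Q.independent {1}"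
    by (subst Q.dependent_single) simp
  ultimately have "finite_dimensional_vector_space (\<lambda>q x :: rat. of_rat q * x) {1}"
    by (intro finite_dimensional_vector_space.intro Q.vector_space_axioms
        finite_dimensional_vector_space_axioms.intro) simp_all
  then show ?thesis
    unfolding number_field_def by blast
qed

definition absolute_value :: "('k::field \<Rightarrow> real) \<Rightarrow> bool" where
  "absolute_value v \<longleftrightarrow>
     (\<forall>x. v x \<ge> 0) \<and> (\<forall>x. v x = 0 \<longleftrightarrow> x = 0) \<and>
     (\<forall>x y. v (x * y) = v x * v y) \<and> (\<forall>x y. v (x + y) \<le> v x + v y)"

definition nontrivial_absolute_values :: "('k::field \<Rightarrow> real) set" where
  "nontrivial_absolute_values = {v. absolute_value v \<and> (\<exists>x. x \<noteq> 0 \<and> v x \<noteq> 1)}"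

definition equivalent_absolute_values :: "(('k::field \<Rightarrow> real) \<times> ('k \<Rightarrow> real)) set" where
  "equivalent_absolute_values =
     {(v, w). v \<in> nontrivial_absolute_values \<and> w \<in> nontrivial_absolute_values \<and>
        (\<exists>s>0. \<forall>x. w x = v x powr s)}"

lemma equiv_equivalent_absolute_values:
  "equiv nontrivial_absolute_values
     (equivalent_absolute_values :: (('k::field \<Rightarrow> real) \<times> ('k \<Rightarrow> real)) set)"
proof (rule equivI)
  show "refl_on nontrivial_absolute_values
          (equivalent_absolute_values :: (('k \<Rightarrow> real) \<times> ('k \<Rightarrow> real)) set)"
    by (auto simp: refl_on_def equivalent_absolute_values_def
        nontrivial_absolute_values_def absolute_value_def intro!: exI[of _ 1])
  show "sym (equivalent_absolute_values :: (('k \<Rightarrow> real) \<times> ('k \<Rightarrow> real)) set)"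
  proof (rule symI)
    fix v w :: "'k \<Rightarrow> real"
    assume "(v, w) \<in> equivalent_absolute_values"
    then obtain s where s: "s > 0" "\<forall>x. w x = v x powr s"
      and vw: "v \<in> nontrivial_absolute_values" "w \<in> nontrivial_absolute_values"
      by (auto simp: equivalent_absolute_values_def)
    then have "\<forall>x. v x = w x powr (1 / s)"
      by (auto simp: powr_powr nontrivial_absolute_values_def absolute_value_def)
    with s vw show "(w, v) \<in> equivalent_absolute_values"
      unfolding equivalent_absolute_values_def by (auto intro!: exI[of _ "1 / s"])
  qed
  show "trans (equivalent_absolute_values :: (('k \<Rightarrow> real) \<times> ('k \<Rightarrow> real)) set)"
  proof (rule transI)
    fix u v w :: "'k \<Rightarrow> real"
    assume "(u, v) \<in> equivalent_absolute_values" "(v, w) \<in> equivalent_absolute_values"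
    then obtain s t where "s > 0" "\<forall>x. v x = u x powr s" "t > 0" "\<forall>x. w x = v x powr t"
      and "u \<in> nontrivial_absolute_values" "w \<in> nontrivial_absolute_values"
      by (auto simp: equivalent_absolute_values_def)
    then show "(u, w) \<in> equivalent_absolute_values"
      unfolding equivalent_absolute_values_def
      by (auto simp: powr_powr intro!: exI[of _ "s * t"])
  qed
qed (auto simp: equivalent_absolute_values_def)

definition places :: "('k::field \<Rightarrow> real) set set" where
  "places = nontrivial_absolute_values // equivalent_absolute_values"

definition nonarchimedean :: "('k::field \<Rightarrow> real) \<Rightarrow> bool" where
  "nonarchimedean v \<longleftrightarrow> (\<forall>x y. v (x + y) \<le> max (v x) (v y))"

text \<open>
  The conditions below are invariant under equivalence of absolute values, so they may be
  tested on any one representative of a place or, as here, on all of them.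
\<close>

definition archimedean_places :: "('k::field \<Rightarrow> real) set set" where
  "archimedean_places = {P \<in> places. \<forall>v\<in>P. \<not> nonarchimedean v}"

definition S_integers :: "('k::field \<Rightarrow> real) set set \<Rightarrow> 'k set" where
  "S_integers S = {x. \<forall>P \<in> places - S. \<forall>v\<in>P. v x \<le> 1}"

definition S_units :: "('k::field \<Rightarrow> real) set set \<Rightarrow> 'k set" where
  "S_units S = {x \<in> S_integers S. \<exists>y \<in> S_integers S. x * y = 1}"

text \<open>The orbit starts at the first iterate, so it need not contain \<open>\<alpha>\<close> itself.\<close>

definition forward_orbit :: "'k::comm_semiring_0 poly \<Rightarrow> 'k \<Rightarrow> 'k set" where
  "forward_orbit \<phi> \<alpha> = {(poly \<phi> ^^ n) \<alpha> | n. n \<ge> 1}"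

end

(* Since beta is not an S-integer, some place outside S, necessarily non-archimedean, is given by
   an absolute value v with v beta > 1. If x is an S-unit, then v x = 1 and beta x^i dominates
   phi(x), so v (phi(x)) = v beta. From there on the leading term dominates, because
   i <= deg phi_0 - 2: if v x >= v beta, then v (phi(x)) = v x ^ deg phi_0 >= v beta. Hence no later
   point of the orbit is an S-unit. *)
theory Submission
  imports Defs
begin

locale nonarchimedean_absolute_value =
  fixes v :: "'k::field \<Rightarrow> real"
  assumes absolute_value: "absolute_value v"
    and nonarchimedean: "nonarchimedean v"
begin

lemma nonneg [simp]: "v x \<ge> 0"
  and eq_0_iff [simp]: "v x = 0 \<longleftrightarrow> x = 0"
  and mult: "v (x * y) = v x * v y"
  using absolute_value by (auto simp: absolute_value_def)

lemma zero [simp]: "v 0 = 0"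
  by simp

lemma one [simp]: "v 1 = 1"
  using mult[of 1 1] by simp

lemma power: "v (x ^ n) = v x ^ n"
  by (induction n) (simp_all add: mult)

lemma minus [simp]: "v (- x) = v x"
proof -
  have "v (- 1) ^ 2 = 1"
    by (simp flip: power)
  then have "v (- 1) = 1"
    using nonneg[of "- 1"] by (simp add: power2_eq_1_iff)
  then show ?thesis
    using mult[of "- 1" x] by simp
qed

lemma add_le_max: "v (x + y) \<le> max (v x) (v y)"
  using nonarchimedean by (simp add: nonarchimedean_def)

text \<open>Since x = (x + y) + (-y) and \<open>v (- y) = v y < v x\<close>, the maximum in the
  ultrametric inequality can only be attained by \<open>v (x + y)\<close>.\<close>

lemma add_eq_left:
  assumes "v y < v x"
  shows "v (x + y) = v x"
proof (rule antisym)
  show "v (x + y) \<le> v x"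
    using add_le_max[of x y] assms by simp
  show "v x \<le> v (x + y)"
    using add_le_max[of "x + y" "- y"] assms by simp
qed

text \<open>\<open>C \<ge> 0\<close> covers the empty sum, and also an infinite \<open>A\<close>,
  for which the sum is 0 by convention.\<close>

lemma sum_le:
  assumes "\<And>j. j \<in> A \<Longrightarrow> v (f j) \<le> C" and "C \<ge> 0"
  shows "v (\<Sum>j\<in>A. f j) \<le> C"
  using assms(1)
proof (induction A rule: infinite_finite_induct)
  case (insert j A)
  then have "v (f j) \<le> C" "v (\<Sum>j\<in>A. f j) \<le> C"
    by simp_all
  then show ?case
    using add_le_max[of "f j" "\<Sum>j\<in>A. f j"] insert.hyps by simp
qed (use \<open>C \<ge> 0\<close> in simp_all)

lemma poly_le_1:
  assumes "\<And>j. v (coeff p j) \<le> 1" and "v x \<le> 1"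
  shows "v (poly p x) \<le> 1"
  unfolding poly_altdef
  by (rule sum_le) (use assms in \<open>auto simp: mult power power_le_one intro!: mult_le_one\<close>)

lemma poly_add_monom_of_unit:
  assumes "\<And>j. v (coeff p j) \<le> 1" and "v x = 1" and "v \<beta> > 1"
  shows "v (poly (p + monom \<beta> i) x) = v \<beta>"
proof -
  have "v (poly p x) \<le> 1"
    using assms by (intro poly_le_1) auto
  then have "v (poly p x) < v (\<beta> * x ^ i)"
    using assms by (simp add: mult power)
  from add_eq_left[OF this] show ?thesis
    using assms by (simp add: poly_monom mult power add.commute)
qed

lemma poly_add_monom_of_large:
  assumes coeff_le: "\<And>j. v (coeff p j) \<le> 1" and monic: "lead_coeff p = 1"
    and i: "i < degree p - 1" and "v \<beta> > 1" and x: "v x \<ge> v \<beta>"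
  shows "v (poly (p + monom \<beta> i) x) = v x ^ degree p"
proof -
  define d where "d = degree p"
  \<comment> \<open>Everything except the leading term. Bounding both summands by
    \<open>v x ^ (d - 1)\<close> suffices, since \<open>v x > 1\<close> makes this strictly smaller
    than \<open>v x ^ d\<close>.\<close>
  define r where "r = (\<Sum>j<d. coeff p j * x ^ j) + \<beta> * x ^ i"
  have x1: "v x > 1"
    using assms by simp
  have "poly p x = x ^ d + (\<Sum>j<d. coeff p j * x ^ j)"
    using monic by (simp add: poly_altdef d_def flip: lessThan_Suc_atMost)
  then have split: "poly (p + monom \<beta> i) x = x ^ d + r"
    by (simp add: r_def poly_monom)
  have "v (\<Sum>j<d. coeff p j * x ^ j) \<le> v x ^ (d - 1)"
  proof (rule sum_le)
    fix j assume "j \<in> {..<d}"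
    then have "v x ^ j \<le> v x ^ (d - 1)"
      using x1 by (intro power_increasing) auto
    moreover have "v (coeff p j) * v x ^ j \<le> v x ^ j"
      using coeff_le[of j] by (simp add: mult_left_le_one_le)
    ultimately show "v (coeff p j * x ^ j) \<le> v x ^ (d - 1)"
      by (simp add: mult power)
  qed simp
  moreover have "v (\<beta> * x ^ i) \<le> v x ^ (d - 1)"
  proof -
    \<comment> \<open>The factor \<open>\<beta>\<close> is traded for one more power of x, using
      \<open>v x \<ge> v \<beta>\<close>; the gap \<open>i < degree p - 1\<close> leaves room for
      that power.\<close>
    have "v (\<beta> * x ^ i) \<le> v x ^ Suc i"
      using x by (simp add: mult power mult_right_mono)
    also have "\<dots> \<le> v x ^ (d - 1)"
      using x1 i by (intro power_increasing) (auto simp: d_def)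
    finally show ?thesis .
  qed
  ultimately have "v r \<le> v x ^ (d - 1)"
    unfolding r_def by (intro order.trans[OF add_le_max]) simp
  also have "\<dots> < v x ^ d"
    using x1 i by (intro power_strict_increasing) (auto simp: d_def)
  finally show ?thesis
    using add_eq_left[of r "x ^ d"] by (simp add: split power d_def del: poly_add)
qed

text \<open>The bound fails at x itself, where \<open>v x = 1\<close>, so the induction starts at
  the first iterate. From then on the region \<open>v y \<ge> v \<beta>\<close> is mapped into
  itself.\<close>

lemma iterate_ge_of_unit:
  assumes "\<And>j. v (coeff p j) \<le> 1" and "lead_coeff p = 1"
    and i: "i < degree p - 1" and \<beta>: "v \<beta> > 1" and "v x = 1"
  shows "v ((poly (p + monom \<beta> i) ^^ Suc n) x) \<ge> v \<beta>"
proof (induction n)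
  case 0
  show ?case
    using assms by (simp add: poly_add_monom_of_unit del: poly_add)
next
  case (Suc n)
  define y where "y = (poly (p + monom \<beta> i) ^^ Suc n) x"
  have y: "v y \<ge> v \<beta>"
    using Suc by (simp only: y_def)
  have "v y \<le> v y ^ degree p"
    using y \<beta> i by (intro self_le_power) auto
  also have "\<dots> = v (poly (p + monom \<beta> i) y)"
    using assms y by (intro poly_add_monom_of_large[symmetric]) auto
  finally show ?case
    using y by (simp add: y_def del: poly_add)
qed

end

text \<open>The map t to t^s with s > 0 is increasing on nonnegative reals, hence commutes with
  \<open>max\<close>.\<close>

lemma nonarchimedean_equivalent:
  assumes "(v, w) \<in> equivalent_absolute_values" and "nonarchimedean v"
  shows "nonarchimedean w"
proof -
  obtain s where s: "s > 0" "\<And>x. w x = v x powr s" and v: "\<And>x. v x \<ge> 0"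
    using assms(1)
    by (auto simp: equivalent_absolute_values_def nontrivial_absolute_values_def absolute_value_def)
  have "w (x + y) \<le> max (w x) (w y)" for x y
  proof -
    have "w (x + y) \<le> max (v x) (v y) powr s"
      using assms(2) s v by (simp add: nonarchimedean_def powr_mono2)
    then show ?thesis
      by (auto simp: s(2) max_def split: if_splits)
  qed
  then show ?thesis
    by (simp add: nonarchimedean_def)
qed

text \<open>Not lying in \<open>archimedean_places\<close> only provides some nonarchimedean
  \<open>w\<close> in the place; equivalence carries the property over to the given
  \<open>v\<close>.\<close>

lemma nonarchimedean_absolute_value_of_place:
  assumes P: "P \<in> places" "P \<notin> archimedean_places" and v: "v \<in> P"
  shows "nonarchimedean_absolute_value v"
proof
  obtain w where w: "w \<in> P" "nonarchimedean w"
    using P by (auto simp: archimedean_places_def)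
  have "(w, v) \<in> equivalent_absolute_values"
    using quotient_eq_iff[OF equiv_equivalent_absolute_values] P(1) w(1) v
    unfolding places_def by blast
  then show "nonarchimedean v" "absolute_value v"
    using nonarchimedean_equivalent w(2)
    by (auto simp: equivalent_absolute_values_def nontrivial_absolute_values_def)
qed

text \<open>Both x and its inverse have value at most 1, and the two values multiply to 1.\<close>

lemma (in nonarchimedean_absolute_value) S_unit_eq_1:
  assumes "x \<in> S_units S" and "P \<in> places - S" and "v \<in> P"
  shows "v x = 1"
proof -
  obtain y where "v x \<le> 1" "v y \<le> 1" and xy: "x * y = 1"
    using assms unfolding S_units_def S_integers_def by blast
  moreover have "v x * v y = 1"
    by (simp add: xy flip: mult)
  ultimately show ?thesis
    using mult_left_le[of "v y" "v x"] by simp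
qed

theorem theorem1p8:
  fixes S :: "('k::field_char_0 \<Rightarrow> real) set set"
    and \<phi>\<^sub>0 \<phi> :: "'k poly" and \<beta> \<alpha> :: 'k and i :: nat
  assumes "number_field TYPE('k)"
    and "S \<subseteq> places" and "finite S" and "archimedean_places \<subseteq> S"
    and "\<forall>j. coeff \<phi>\<^sub>0 j \<in> S_integers S" and "lead_coeff \<phi>\<^sub>0 = 1"
    and "\<beta> \<notin> S_integers S"
    and "i < degree \<phi>\<^sub>0 - 1"
    and "\<phi> = \<phi>\<^sub>0 + monom \<beta> i"
  shows "finite (forward_orbit \<phi> \<alpha> \<inter> S_units S) \<and>
         card (forward_orbit \<phi> \<alpha> \<inter> S_units S) \<le> 1"
proof -
  obtain P v where P: "P \<in> places - S" and v: "v \<in> P" and \<beta>: "v \<beta> > 1"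
    using \<open>\<beta> \<notin> S_integers S\<close> by (auto simp: S_integers_def not_le)
  interpret nonarchimedean_absolute_value v
    using nonarchimedean_absolute_value_of_place P v \<open>archimedean_places \<subseteq> S\<close> by blast
  have coeff_le: "v (coeff \<phi>\<^sub>0 j) \<le> 1" for j
    using assms(5) P v by (auto simp: S_integers_def)
  \<comment> \<open>The claim compares indices, not points: it also excludes that an orbit returns
    to the same unit.\<close>
  have later: "(poly \<phi> ^^ n) \<alpha> \<notin> S_units S"
    if "m < n" and unit: "(poly \<phi> ^^ m) \<alpha> \<in> S_units S" for m n
  proof
    assume "(poly \<phi> ^^ n) \<alpha> \<in> S_units S"
    then have "v ((poly \<phi> ^^ n) \<alpha>) = 1"
      using P v by (rule S_unit_eq_1)
    \<comment> \<open>The gap n - m is positive, so it has the form \<open>Suc k\<close> required by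
      \<open>iterate_ge_of_unit\<close>, applied with the m-th iterate as starting point.\<close>
    moreover obtain k where "n = Suc k + m"
      using \<open>m < n\<close> by (metis add.commute add_Suc_right less_imp_Suc_add)
    then have "(poly \<phi> ^^ n) \<alpha> = (poly \<phi> ^^ Suc k) ((poly \<phi> ^^ m) \<alpha>)"
      by (simp only: funpow_add o_apply)
    moreover have "v ((poly \<phi> ^^ m) \<alpha>) = 1"
      using unit P v by (rule S_unit_eq_1)
    \<comment> \<open>The n-th iterate would have value 1 and yet at least
      \<open>v \<beta> > 1\<close>.\<close>
    ultimately show False
      using iterate_ge_of_unit[of \<phi>\<^sub>0 i \<beta> "(poly \<phi> ^^ m) \<alpha>" k] coeff_le assms(6,8,9) \<beta> by simp
  qed
  have "x = y" if "x \<in> forward_orbit \<phi> \<alpha> \<inter> S_units S" "y \<in> forward_orbit \<phi> \<alpha> \<inter> S_units S" for x y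
  proof -
    obtain m n where "x = (poly \<phi> ^^ m) \<alpha>" "y = (poly \<phi> ^^ n) \<alpha>"
      using \<open>x \<in> _\<close> \<open>y \<in> _\<close> by (auto simp: forward_orbit_def)
    then show ?thesis
      using later[of m n] later[of n m] that by (cases m n rule: linorder_cases) auto
  qed
  \<comment> \<open>Containment in a singleton also allows an empty intersection, and it yields
    finiteness along with the bound on \<open>card\<close>.\<close>
  then have "\<exists>x. forward_orbit \<phi> \<alpha> \<inter> S_units S \<subseteq> {x}"
    by blast
  then obtain x where "forward_orbit \<phi> \<alpha> \<inter> S_units S \<subseteq> {x}"
    by blast
  then show ?thesis
    using finite_subset[of _ "{x}"] card_mono[of "{x}"] by auto
qed

end
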